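(* Let $G$ be a graph on $n$ vertices with adjacency matrix $A$ and let $k \leq n$ be a positive integer. Let $\tilde{x} \in \{0,1\}^n$ be such that $e^T\tilde{x} = k$, and let $\mu \in \mathbb{R}$ satisfy $\frac{\mu}{2} > \frac{1}{2}\tilde{x}^TA\tilde{x}$. Then: (i) $$\frac{1}{2}\tilde{x}^TA\tilde{x} < \frac{1}{2}x^TAx + \frac{\mu}{2}(e^Tx-k)^2$$ for all $x \in \{0,1\}^n$ with $e^Tx \neq k$. (ii) Any optimal solution of (SkS-Q) with this $\mu$ is an optimal solution of (SkS).
   Context: Graphs are simple, undirected and finite, with vertex set $\{1,\dots,n\}$; $A$ is the adjacency matrix of $G$ and $e$ is the all-ones vector of length $n$. The sparsest $k$-subgraph problem is $$\text{(SkS)}\qquad \min\left\{\tfrac12 x^TAx \mid e^Tx=k,\ x\in\{0,1\}^n\right\}.$$ Its quadratic penalty relaxation with parameter $\mu>0$ is $$\text{(SkS-Q)}\qquad \min\left\{\tfrac12 x^TAx+\tfrac{\mu}{2}(e^Tx-k)^2 \mid x\in\{0,1\}^n\right\}.$$ *)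

theory Defs
  imports "HOL-Analysis.Analysis" "Graph_Theory.Pair_Digraph"
begin

text \<open>The index type \<open>'n\<close> plays the role of the vertex set \<open>{1,\<dots>,n}\<close>, with
  \<open>n = CARD('n)\<close>. A finite simple undirected graph is a \<^const>\<open>pair_graph\<close>, i.e. a finite
  loop-free digraph with symmetric arc relation (an edge \<open>ij\<close> is the pair of arcs
  \<open>(i,j)\<close>, \<open>(j,i)\<close>). The all-ones vector \<open>e\<close> is \<open>1 :: real ^ 'n\<close>, so
  \<open>e\<^sup>T x\<close> is \<open>1 \<bullet> x\<close>.\<close>

definition adjacency_matrix :: "'n::finite pair_pre_digraph \<Rightarrow> real ^ 'n ^ 'n" where
  "adjacency_matrix G = (\<chi> i j. if (i, j) \<in> parcs G then 1 else 0)"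

definition binary_vectors :: "(real ^ 'n) set" where
  "binary_vectors = {x. \<forall>i. x $ i \<in> {0, 1}}"

definition sks_objective :: "real ^ 'n ^ 'n \<Rightarrow> real ^ 'n \<Rightarrow> real" where
  "sks_objective A x = 1 / 2 * (x \<bullet> (A *v x))"

definition sksq_objective :: "real ^ 'n ^ 'n \<Rightarrow> nat \<Rightarrow> real \<Rightarrow> real ^ 'n \<Rightarrow> real" where
  "sksq_objective A k \<mu> x = 1 / 2 * (x \<bullet> (A *v x)) + \<mu> / 2 * (1 \<bullet> x - real k)\<^sup>2"

definition sks_optimal :: "real ^ 'n ^ 'n \<Rightarrow> nat \<Rightarrow> real ^ 'n \<Rightarrow> bool" where
  "sks_optimal A k =
     is_arg_min (sks_objective A) (\<lambda>x. 1 \<bullet> x = real k \<and> x \<in> binary_vectors)"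

definition sksq_optimal :: "real ^ 'n ^ 'n \<Rightarrow> nat \<Rightarrow> real \<Rightarrow> real ^ 'n \<Rightarrow> bool" where
  "sksq_optimal A k \<mu> = is_arg_min (sksq_objective A k \<mu>) (\<lambda>x. x \<in> binary_vectors)"

end

theory Submission
  imports Defs
begin

text \<open>On binary vectors the edge count is nonnegative and \<open>e\<^sup>T x - k\<close> is an integer, so an
  infeasible point pays a penalty of at least \<open>\<mu> / 2\<close>, which already exceeds the value of the
  feasible point. On feasible points both objectives agree.\<close>

text \<open>All entries of \<open>x\<close> and of the adjacency matrix are 0 or 1, so the expanded
  form is a sum of nonnegative products.\<close>

lemma binary_quadratic_form_nonneg:
  fixes x :: "real ^ 'n::finite"
  assumes "x \<in> binary_vectors"
  shows "0 \<le> x \<bullet> (adjacency_matrix G *v x)"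
proof -
  have nonneg: "0 \<le> x $ i" for i
  proof -
    have "x $ i = 0 \<or> x $ i = 1"
      using assms by (simp add: binary_vectors_def)
    then show ?thesis
      by auto
  qed
  show ?thesis
    by (auto simp: inner_vec_def matrix_vector_mult_def adjacency_matrix_def
        intro!: sum_nonneg mult_nonneg_nonneg nonneg)
qed

lemma one_inner_binary_in_Ints:
  fixes x :: "real ^ 'n::finite"
  assumes "x \<in> binary_vectors"
  shows "1 \<bullet> x \<in> \<int>"
proof -
  have "x $ i \<in> \<int>" for i
  proof -
    have "x $ i = 0 \<or> x $ i = 1"
      using assms by (simp add: binary_vectors_def)
    then show ?thesis
      by auto
  qed
  then show ?thesis
    by (auto simp: inner_vec_def intro!: Ints_sum)
qed

lemma sksq_objective_feasible:
  "1 \<bullet> x = real k \<Longrightarrow> sksq_objective A k \<mu> x = sks_objective A x"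
  by (simp add: sksq_objective_def sks_objective_def)

lemma penalty_le_sksq_objective:
  fixes x :: "real ^ 'n::finite"
  assumes x: "x \<in> binary_vectors" and ne: "1 \<bullet> x \<noteq> real k" and "0 \<le> \<mu>"
  shows "\<mu> / 2 \<le> sksq_objective (adjacency_matrix G) k \<mu> x"
proof -
  have "1 \<bullet> x - real k \<in> \<int>"
    using one_inner_binary_in_Ints[OF x] by simp
  then have "1 \<le> \<bar>1 \<bullet> x - real k\<bar>"
    using ne by (intro Ints_nonzero_abs_ge1) auto
  \<comment> \<open>The difference may be negative, so monotonicity of squaring is applied to its
    absolute value.\<close>
  then have "1 \<le> (1 \<bullet> x - real k)\<^sup>2"
    using power_mono[of 1 "\<bar>1 \<bullet> x - real k\<bar>" 2] by simp
  then have "\<mu> / 2 * 1 \<le> \<mu> / 2 * (1 \<bullet> x - real k)\<^sup>2"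
    using \<open>0 \<le> \<mu>\<close> by (intro mult_left_mono) auto
  then show ?thesis
    using binary_quadratic_form_nonneg[OF x, of G] by (simp add: sksq_objective_def)
qed

theorem lemma3:
  fixes G :: "'n::finite pair_pre_digraph"
    and A :: "real ^ 'n ^ 'n"
    and k :: nat
    and xt :: "real ^ 'n"
    and \<mu> :: real
  assumes "pair_graph G" and "pverts G = UNIV"
    and "A = adjacency_matrix G"
    and "0 < k" and "k \<le> CARD('n)"
    and "xt \<in> binary_vectors" and "1 \<bullet> xt = real k"
    and "\<mu> / 2 > 1 / 2 * (xt \<bullet> (A *v xt))"
  shows "(\<forall>x \<in> binary_vectors. 1 \<bullet> x \<noteq> real k \<longrightarrow>
            1 / 2 * (xt \<bullet> (A *v xt))
              < 1 / 2 * (x \<bullet> (A *v x)) + \<mu> / 2 * (1 \<bullet> x - real k)\<^sup>2) \<and>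
         (\<forall>x. sksq_optimal A k \<mu> x \<longrightarrow> sks_optimal A k x)"
proof -
  \<comment> \<open>Half of \<mu> exceeds the value at \<open>xt\<close>, which is itself
    nonnegative.\<close>
  have "0 \<le> \<mu>"
    using binary_quadratic_form_nonneg[OF assms(6), of G] assms(3,8) by simp
  have less: "sks_objective A xt < sksq_objective A k \<mu> x"
    if "x \<in> binary_vectors" "1 \<bullet> x \<noteq> real k" for x
    using penalty_le_sksq_objective[OF that \<open>0 \<le> \<mu>\<close>, of G] assms(3,8)
    by (simp add: sks_objective_def)
  have "sks_optimal A k x" if opt: "sksq_optimal A k \<mu> x" for x
  proof -
    have x: "x \<in> binary_vectors"
      using opt by (simp add: sksq_optimal_def is_arg_min_def)
    have min: "\<not> sksq_objective A k \<mu> y < sksq_objective A k \<mu> x"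
      if "y \<in> binary_vectors" for y
      using opt that by (auto simp: sksq_optimal_def is_arg_min_def)
    \<comment> \<open>Otherwise \<open>less\<close> would make \<open>xt\<close>, whose penalty
      vanishes, strictly better than the minimizer \<open>x\<close>.\<close>
    have feasible: "1 \<bullet> x = real k"
      using less[OF x] min[OF assms(6)] sksq_objective_feasible[OF assms(7)] by auto
    \<comment> \<open>Feasible competitors are binary, so \<open>min\<close> covers them. The
      flipped equation turns both values into penalized ones; \<open>k\<close> and \<mu> are fixed
      because its left side would not determine them.\<close>
    show ?thesis
      using min x feasible
      by (auto simp: sks_optimal_def is_arg_min_def
          simp flip: sksq_objective_feasible[of _ k A \<mu>])
  qed
  then show ?thesis
    using less by (simp add: sks_objective_def sksq_objective_def)
qed

end
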